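(* Let $\alpha,\beta,\gamma\in\mathbb{R}$ with $\gamma\neq 0$, and let $(G_2,g,J)$ be the connected, simply connected three-dimensional Lie group with left-invariant Lorentzian metric $g$ whose Lie algebra $\mathfrak{g}$ has a pseudo-orthonormal basis $\{e_1,e_2,e_3\}$ with $e_3$ timelike such that $$[e_1,e_2]=\gamma e_2-\beta e_3,\quad [e_1,e_3]=-\beta e_2-\gamma e_3,\quad [e_2,e_3]=\alpha e_1,$$ equipped with the product structure $Je_1=e_1$, $Je_2=e_2$, $Je_3=-e_3$. Let $c\in\mathbb{R}$. Then $(G_2,g,J)$ is a first kind algebraic Wanas soliton associated to the canonical connection $\nabla^0$ with constant $c$ (i.e. $\mathrm{Wan}^0=c\,\mathrm{Id}+D$ with $D$ a derivation of $\mathfrak g$) if and only if $\alpha=\beta=0$, $2\gamma^2+c=0$ and $\gamma\neq 0$. In particular, in this case $De_1=0$, $De_2=\gamma^2e_2$, $De_3=2\gamma^2e_3$.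
   Context: Pseudo-orthonormal with $e_3$ timelike means $g(e_1,e_1)=g(e_2,e_2)=1$, $g(e_3,e_3)=-1$, $g(e_i,e_j)=0$ for $i\ne j$. All tensors are left-invariant and evaluated on the Lie algebra $\mathfrak{g}$ of left-invariant vector fields. Let $\nabla$ be the Levi-Civita connection of $g$, and let $J$ be the product structure given in the claim, with $(\nabla_XJ)Y=\nabla_X(JY)-J(\nabla_XY)$. Canonical connection: $\nabla^0_XY=\nabla_XY-\frac12(\nabla_XJ)JY$. Curvature: $R^0(X,Y)Z=\nabla^0_X\nabla^0_YZ-\nabla^0_Y\nabla^0_XZ-\nabla^0_{[X,Y]}Z$. Torsion: $T^0(X,Y)=\nabla^0_XY-\nabla^0_YX-[X,Y]$. $A^0(X,Y)Z=T^0(T^0(X,Y),Z)$, and the Wanas tensor is $W^0(X,Y)Z=R^0(X,Y)Z-A^0(X,Y)Z$. $w^0(X,Y)=-g(W^0(X,e_1)Y,e_1)-g(W^0(X,e_2)Y,e_2)+g(W^0(X,e_3)Y,e_3)$. The operator $\mathrm{Wan}^0:\mathfrak g\to\mathfrak g$ is defined by $w^0(X,Y)=g(\mathrm{Wan}^0(X),Y)$. A derivation of $\mathfrak g$ is a linear map $D$ with $D[X,Y]=[DX,Y]+[X,DY]$ for all $X,Y\in\mathfrak g$. $(G_2,g,J)$ is a first kind algebraic Wanas soliton associated to $\nabla^0$ (with constant $c$) if $\mathrm{Wan}^0=c\,\mathrm{Id}+D$ for the real number $c$ and a derivation $D$ of $\mathfrak g$. *)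

theory Defs
  imports "HOL-Analysis.Analysis"
begin

text \<open>
  The Lie algebra of left-invariant vector fields of the Lie group is a real vector space
  \<open>'a\<close> with bracket \<open>br\<close>.  All tensors are left-invariant, so they are maps on \<open>'a\<close>;
  for left-invariant \<open>X\<close>, \<open>Y\<close>, \<open>Z\<close> the function \<open>g Y Z\<close> is constant, hence its derivative
  along \<open>X\<close> vanishes and connections are bilinear maps on \<open>'a\<close>.
\<close>

definition lie_bracket :: "('a::real_vector \<Rightarrow> 'a \<Rightarrow> 'a) \<Rightarrow> bool" where
  "lie_bracket br \<longleftrightarrow>
     bilinear br \<and>
     (\<forall>X. br X X = 0) \<and>
     (\<forall>X Y Z. br X (br Y Z) + br Y (br Z X) + br Z (br X Y) = 0)"

definition lie_derivation :: "('a::real_vector \<Rightarrow> 'a \<Rightarrow> 'a) \<Rightarrow> ('a \<Rightarrow> 'a) \<Rightarrow> bool" where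
  "lie_derivation br D \<longleftrightarrow> linear D \<and> (\<forall>X Y. D (br X Y) = br (D X) Y + br X (D Y))"

text \<open>
  A symmetric bilinear form having such a basis is automatically nondegenerate and Lorentzian.
\<close>

definition pseudo_orthonormal_basis ::
  "('a::real_vector \<Rightarrow> 'a \<Rightarrow> real) \<Rightarrow> 'a \<Rightarrow> 'a \<Rightarrow> 'a \<Rightarrow> bool" where
  "pseudo_orthonormal_basis g e1 e2 e3 \<longleftrightarrow>
     distinct [e1, e2, e3] \<and> independent {e1, e2, e3} \<and> span {e1, e2, e3} = UNIV \<and>
     g e1 e1 = 1 \<and> g e2 e2 = 1 \<and> g e3 e3 = - 1 \<and>
     g e1 e2 = 0 \<and> g e2 e1 = 0 \<and> g e1 e3 = 0 \<and> g e3 e1 = 0 \<and> g e2 e3 = 0 \<and> g e3 e2 = 0"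

definition is_levi_civita ::
  "('a::real_vector \<Rightarrow> 'a \<Rightarrow> 'a) \<Rightarrow> ('a \<Rightarrow> 'a \<Rightarrow> real) \<Rightarrow> ('a \<Rightarrow> 'a \<Rightarrow> 'a) \<Rightarrow> bool" where
  "is_levi_civita br g nab \<longleftrightarrow>
     bilinear nab \<and>
     (\<forall>X Y. nab X Y - nab Y X = br X Y) \<and>
     (\<forall>X Y Z. g (nab X Y) Z + g Y (nab X Z) = 0)"

definition levi_civita ::
  "('a::real_vector \<Rightarrow> 'a \<Rightarrow> 'a) \<Rightarrow> ('a \<Rightarrow> 'a \<Rightarrow> real) \<Rightarrow> 'a \<Rightarrow> 'a \<Rightarrow> 'a" where
  "levi_civita br g = (THE nab. is_levi_civita br g nab)"

definition cov_deriv_endo ::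
  "('a::real_vector \<Rightarrow> 'a \<Rightarrow> 'a) \<Rightarrow> ('a \<Rightarrow> 'a) \<Rightarrow> 'a \<Rightarrow> 'a \<Rightarrow> 'a" where
  "cov_deriv_endo nab J X Y = nab X (J Y) - J (nab X Y)"

definition canonical_connection ::
  "('a::real_vector \<Rightarrow> 'a \<Rightarrow> 'a) \<Rightarrow> ('a \<Rightarrow> 'a \<Rightarrow> real) \<Rightarrow> ('a \<Rightarrow> 'a) \<Rightarrow> 'a \<Rightarrow> 'a \<Rightarrow> 'a" where
  "canonical_connection br g J X Y =
     levi_civita br g X Y - (1/2) *\<^sub>R cov_deriv_endo (levi_civita br g) J X (J Y)"

definition curvature ::
  "('a::real_vector \<Rightarrow> 'a \<Rightarrow> 'a) \<Rightarrow> ('a \<Rightarrow> 'a \<Rightarrow> 'a) \<Rightarrow> 'a \<Rightarrow> 'a \<Rightarrow> 'a \<Rightarrow> 'a" where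
  "curvature br nab X Y Z = nab X (nab Y Z) - nab Y (nab X Z) - nab (br X Y) Z"

definition torsion ::
  "('a::real_vector \<Rightarrow> 'a \<Rightarrow> 'a) \<Rightarrow> ('a \<Rightarrow> 'a \<Rightarrow> 'a) \<Rightarrow> 'a \<Rightarrow> 'a \<Rightarrow> 'a" where
  "torsion br nab X Y = nab X Y - nab Y X - br X Y"

definition wanas_tensor ::
  "('a::real_vector \<Rightarrow> 'a \<Rightarrow> 'a) \<Rightarrow> ('a \<Rightarrow> 'a \<Rightarrow> 'a) \<Rightarrow> 'a \<Rightarrow> 'a \<Rightarrow> 'a \<Rightarrow> 'a" where
  "wanas_tensor br nab X Y Z =
     curvature br nab X Y Z - torsion br nab (torsion br nab X Y) Z"

definition wanas_form0 ::
  "('a::real_vector \<Rightarrow> 'a \<Rightarrow> 'a) \<Rightarrow> ('a \<Rightarrow> 'a \<Rightarrow> real) \<Rightarrow> ('a \<Rightarrow> 'a) \<Rightarrow> 'a \<Rightarrow> 'a \<Rightarrow> 'a \<Rightarrow>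
    'a \<Rightarrow> 'a \<Rightarrow> real" where
  "wanas_form0 br g J e1 e2 e3 X Y =
     (let W0 = wanas_tensor br (canonical_connection br g J)
      in - g (W0 X e1 Y) e1 - g (W0 X e2 Y) e2 + g (W0 X e3 Y) e3)"

definition Wan0 ::
  "('a::real_vector \<Rightarrow> 'a \<Rightarrow> 'a) \<Rightarrow> ('a \<Rightarrow> 'a \<Rightarrow> real) \<Rightarrow> ('a \<Rightarrow> 'a) \<Rightarrow> 'a \<Rightarrow> 'a \<Rightarrow> 'a \<Rightarrow>
    'a \<Rightarrow> 'a" where
  "Wan0 br g J e1 e2 e3 =
     (THE L. linear L \<and> (\<forall>X Y. wanas_form0 br g J e1 e2 e3 X Y = g (L X) Y))"

definition first_kind_algebraic_wanas_soliton0 ::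
  "('a::real_vector \<Rightarrow> 'a \<Rightarrow> 'a) \<Rightarrow> ('a \<Rightarrow> 'a \<Rightarrow> real) \<Rightarrow> ('a \<Rightarrow> 'a) \<Rightarrow> 'a \<Rightarrow> 'a \<Rightarrow> 'a \<Rightarrow>
    real \<Rightarrow> bool" where
  "first_kind_algebraic_wanas_soliton0 br g J e1 e2 e3 c \<longleftrightarrow>
     (\<exists>D. lie_derivation br D \<and> (\<forall>X. Wan0 br g J e1 e2 e3 X = c *\<^sub>R X + D X))"

end

theory Submission
  imports Defs
begin

text \<open>
  The canonical connection commutes with \<open>J\<close> and is metric, so \<open>e3\<close> is parallel and the connection
  is a rotation by a 1-form in the plane of \<open>e1\<close>, \<open>e2\<close>.  In the given basis the Wanas operator has
  \<open>e1\<close> as an eigenvector and preserves the plane \<open>P\<close> spanned by \<open>e2\<close>, \<open>e3\<close>.  Let \<open>D\<close> be its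
  difference with \<open>c Id\<close>, let \<open>d1\<close> be the eigenvalue of \<open>D\<close> at \<open>e1\<close>, and let \<open>M\<close> be the
  restriction of \<open>ad e1\<close> to \<open>P\<close>, a traceless matrix.  If \<open>D\<close> is a derivation then
  \<open>D M - M D = d1 M\<close> on \<open>P\<close>; multiplying by \<open>M\<close> and taking traces gives \<open>d1 = 0\<close>, so \<open>D\<close> commutes
  with \<open>M\<close>, which yields \<open>2 \<beta> = 3 \<alpha>\<close>.  Moreover \<open>\<alpha> \<noteq> 0\<close> would force \<open>D\<close> to be traceless on \<open>P\<close>,
  which contradicts the signs of the entries.
\<close>

section \<open>Linear algebra in a pseudo-orthonormal frame\<close>

locale pseudo_orthonormal_frame =
  fixes g :: "'a::real_vector \<Rightarrow> 'a \<Rightarrow> real" and e1 e2 e3 :: 'a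
  assumes bilinear_g: "bilinear g"
    and g_sym: "g X Y = g Y X"
    and frame: "pseudo_orthonormal_basis g e1 e2 e3"
begin

lemmas g_simps = bilinear_ladd[OF bilinear_g] bilinear_radd[OF bilinear_g]
  bilinear_lsub[OF bilinear_g] bilinear_rsub[OF bilinear_g]
  bilinear_lmul[OF bilinear_g] bilinear_rmul[OF bilinear_g]
  bilinear_lneg[OF bilinear_g] bilinear_rneg[OF bilinear_g]
  bilinear_lzero[OF bilinear_g] bilinear_rzero[OF bilinear_g]

lemma g_frame [simp]:
  "g e1 e1 = 1" "g e2 e2 = 1" "g e3 e3 = - 1"
  "g e1 e2 = 0" "g e2 e1 = 0" "g e1 e3 = 0" "g e3 e1 = 0" "g e2 e3 = 0" "g e3 e2 = 0"
  using frame by (auto simp: pseudo_orthonormal_basis_def)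

text \<open>The minus sign comes from \<open>g e3 e3 = - 1\<close>: pairing with \<open>e3\<close>
  returns the negative of the third coordinate.\<close>

lemma frame_expansion: "V = g V e1 *\<^sub>R e1 + g V e2 *\<^sub>R e2 - g V e3 *\<^sub>R e3"
proof -
  have "V \<in> span {e1, e2, e3}"
    using frame by (auto simp: pseudo_orthonormal_basis_def)
  then obtain a b c where "V - a *\<^sub>R e1 - b *\<^sub>R e2 - c *\<^sub>R e3 = 0"
    by (auto simp: span_breakdown_eq)
  then have V: "V = a *\<^sub>R e1 + b *\<^sub>R e2 + c *\<^sub>R e3"
    by (simp add: algebra_simps)
  have "g V e1 = a" "g V e2 = b" "g V e3 = - c"
    by (simp_all add: V g_simps)
  with V show ?thesis by simp
qed

lemma frame_eqI:
  assumes "g U e1 = g V e1" "g U e2 = g V e2" "g U e3 = g V e3"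
  shows "U = V"
  using frame_expansion[of U] frame_expansion[of V] assms by simp

text \<open>Nondegeneracy of \<open>g\<close>, in the form that settles the uniqueness claims
  below.\<close>

lemma g_eqI: "(\<And>Z. g U Z = g V Z) \<Longrightarrow> U = V"
  by (rule frame_eqI) auto

lemma linear_frame_expansion:
  assumes "linear f"
  shows "f V = g V e1 *\<^sub>R f e1 + g V e2 *\<^sub>R f e2 - g V e3 *\<^sub>R f e3"
proof -
  have "f V = f (g V e1 *\<^sub>R e1 + g V e2 *\<^sub>R e2 - g V e3 *\<^sub>R e3)"
    using frame_expansion[of V] by simp
  also have "\<dots> = g V e1 *\<^sub>R f e1 + g V e2 *\<^sub>R f e2 - g V e3 *\<^sub>R f e3"
    by (simp add: linear_add[OF assms] linear_diff[OF assms] linear_cmul[OF assms])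
  finally show ?thesis .
qed

lemma linear_eqI:
  assumes "linear f" "linear h" "f e1 = h e1" "f e2 = h e2" "f e3 = h e3"
  shows "f = h"
proof
  fix V
  show "f V = h V"
    using linear_frame_expansion[OF assms(1), of V] linear_frame_expansion[OF assms(2), of V]
    by (simp add: assms)
qed

lemma bilinear_eqI:
  assumes "bilinear B" "bilinear C"
    and "B e1 e1 = C e1 e1" "B e1 e2 = C e1 e2" "B e1 e3 = C e1 e3"
    and "B e2 e1 = C e2 e1" "B e2 e2 = C e2 e2" "B e2 e3 = C e2 e3"
    and "B e3 e1 = C e3 e1" "B e3 e2 = C e3 e2" "B e3 e3 = C e3 e3"
  shows "B = C"
proof -
  have lin: "linear (\<lambda>X. B X Y)" "linear (\<lambda>X. C X Y)" "linear (B X)" "linear (C X)" for X Y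
    using assms(1,2) by (auto simp: bilinear_def)
  have "B e1 = C e1" "B e2 = C e2" "B e3 = C e3"
    by (rule linear_eqI[OF lin(3,4)]; simp add: assms)+
  then have "(\<lambda>X. B X Y) = (\<lambda>X. C X Y)" for Y
    by (intro linear_eqI[OF lin(1,2)]) simp_all
  then show ?thesis by (metis ext)
qed

text \<open>The musical isomorphism: for linear \<open>f\<close> this is the vector that represents
  \<open>f\<close> through \<open>g\<close>.\<close>

definition sharp :: "('a \<Rightarrow> real) \<Rightarrow> 'a" where
  "sharp f = f e1 *\<^sub>R e1 + f e2 *\<^sub>R e2 - f e3 *\<^sub>R e3"

lemma g_sharp:
  assumes "linear f"
  shows "g (sharp f) Z = f Z"
  using linear_frame_expansion[OF assms, of Z]
  by (simp add: sharp_def g_simps g_sym[of _ Z])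

end

section \<open>The Levi-Civita connection of a left-invariant metric\<close>

locale framed_lie_algebra = pseudo_orthonormal_frame +
  fixes br :: "'a::real_vector \<Rightarrow> 'a \<Rightarrow> 'a"
  assumes lie: "lie_bracket br"
begin

lemma bilinear_br: "bilinear br" and br_self [simp]: "br X X = 0"
  using lie by (auto simp: lie_bracket_def)

lemmas br_simps = bilinear_ladd[OF bilinear_br] bilinear_radd[OF bilinear_br]
  bilinear_lsub[OF bilinear_br] bilinear_rsub[OF bilinear_br]
  bilinear_lmul[OF bilinear_br] bilinear_rmul[OF bilinear_br]
  bilinear_lneg[OF bilinear_br] bilinear_rneg[OF bilinear_br]
  bilinear_lzero[OF bilinear_br] bilinear_rzero[OF bilinear_br]

lemma br_skew: "br X Y = - br Y X"
proof -
  have "br X Y + br Y X = 0"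
    using br_self[of "X + Y"] unfolding br_simps by (simp add: add.commute)
  then show ?thesis by (simp add: eq_neg_iff_add_eq_0)
qed

text \<open>Right-hand side of the Koszul formula; its derivative terms vanish because
  \<open>g\<close> is constant on left-invariant fields.\<close>

definition koszul :: "'a \<Rightarrow> 'a \<Rightarrow> 'a \<Rightarrow> real" where
  "koszul X Y Z = (g (br X Y) Z - g (br Y Z) X + g (br Z X) Y) / 2"

lemma linear_koszul:
  "linear (\<lambda>X. koszul X Y Z)" "linear (\<lambda>Y. koszul X Y Z)" "linear (koszul X Y)"
  by (rule linearI; simp add: koszul_def g_simps br_simps field_simps)+

text \<open>Uniqueness: vanishing torsion turns the three brackets into six connection terms. Metric
  compatibility cancels four of them and makes the remaining two equal.\<close>

lemma is_levi_civita_imp_koszul: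
  assumes "is_levi_civita br g nab"
  shows "g (nab X Y) Z = koszul X Y Z"
proof -
  have tor: "br U V = nab U V - nab V U" for U V
    using assms by (simp add: is_levi_civita_def)
  have met: "g (nab U V) W = - g (nab U W) V" for U V W
    using assms unfolding is_levi_civita_def eq_neg_iff_add_eq_0 by (metis g_sym)
  show ?thesis
    unfolding koszul_def tor
    using met[of X Y Z] met[of Y Z X] met[of Z X Y]
    by (simp add: g_simps)
qed

text \<open>Existence: torsion-freeness and metricity are read off \<open>koszul\<close> by
  skew-symmetry of the bracket.\<close>

lemma is_levi_civita_sharp_koszul: "is_levi_civita br g (\<lambda>X Y. sharp (koszul X Y))"
  unfolding is_levi_civita_def
proof (intro conjI allI)
  have K: "g (sharp (koszul X Y)) Z = koszul X Y Z" for X Y Z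
    by (rule g_sharp) (rule linear_koszul)
  show "bilinear (\<lambda>X Y. sharp (koszul X Y))"
    unfolding bilinear_def
    by (intro conjI allI linearI g_eqI)
      (simp_all add: g_simps K linear_koszul[THEN linear_add] linear_koszul[THEN linear_cmul])
  fix X Y
  show "sharp (koszul X Y) - sharp (koszul Y X) = br X Y"
  proof (rule g_eqI)
    fix Z
    show "g (sharp (koszul X Y) - sharp (koszul Y X)) Z = g (br X Y) Z"
      using br_skew[of Y X] br_skew[of Z X] br_skew[of Z Y]
      by (simp add: g_simps K koszul_def field_simps)
  qed
  fix Z
  show "g (sharp (koszul X Y)) Z + g Y (sharp (koszul X Z)) = 0"
    using br_skew[of X Z] br_skew[of Y X] br_skew[of Z Y]
    by (simp add: g_sym[of Y] K koszul_def g_simps field_simps)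
qed

lemma levi_civita_eq: "levi_civita br g X Y = sharp (koszul X Y)"
proof -
  have "levi_civita br g = (\<lambda>X Y. sharp (koszul X Y))"
    unfolding levi_civita_def
  proof (rule the_equality)
    fix nab assume "is_levi_civita br g nab"
    then show "nab = (\<lambda>X Y. sharp (koszul X Y))"
      by (intro ext g_eqI)
        (simp add: is_levi_civita_imp_koszul is_levi_civita_imp_koszul[OF is_levi_civita_sharp_koszul])
  qed (rule is_levi_civita_sharp_koszul)
  then show ?thesis by simp
qed

lemma bilinear_levi_civita: "bilinear (levi_civita br g)"
  using is_levi_civita_sharp_koszul by (simp add: is_levi_civita_def levi_civita_eq[abs_def])

section \<open>Linearity of the canonical connection and of the Wanas operator\<close>

lemma bilinear_canonical_connection:
  assumes J: "linear J"
  shows "bilinear (canonical_connection br g J)"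
proof -
  note N = bilinear_levi_civita
  show ?thesis
    unfolding bilinear_def
    by (intro conjI allI linearI)
      (simp_all add: canonical_connection_def cov_deriv_endo_def linear_add[OF J] linear_cmul[OF J]
        bilinear_ladd[OF N] bilinear_radd[OF N] bilinear_lmul[OF N] bilinear_rmul[OF N]
        algebra_simps)
qed

text \<open>These are the two slots that receive the arguments of \<open>wanas_form0\<close>; frame
  vectors fill the middle one.\<close>

lemma linear_wanas_tensor:
  assumes N: "bilinear nab"
  shows "linear (\<lambda>X. wanas_tensor br nab X Y Z)" "linear (wanas_tensor br nab X Y)"
  by (rule linearI; simp add: wanas_tensor_def curvature_def torsion_def br_simps
        bilinear_ladd[OF N] bilinear_radd[OF N] bilinear_lmul[OF N] bilinear_rmul[OF N]
        bilinear_lsub[OF N] bilinear_rsub[OF N] algebra_simps)+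

lemma bilinear_wanas_form0:
  assumes "linear J"
  shows "bilinear (wanas_form0 br g J e1 e2 e3)"
proof -
  note W = linear_wanas_tensor[OF bilinear_canonical_connection[OF assms]]
  show ?thesis
    unfolding bilinear_def
    by (intro conjI allI linearI)
      (simp_all add: wanas_form0_def Let_def W[THEN linear_add] W[THEN linear_cmul] g_simps
        algebra_simps)
qed

text \<open>Resolves the definite description: \<open>sharp\<close> supplies a representing
  operator, and nondegeneracy makes it the only one.\<close>

lemma Wan0_eq:
  assumes "linear J"
  shows "linear (Wan0 br g J e1 e2 e3)"
    and "Wan0 br g J e1 e2 e3 X = sharp (wanas_form0 br g J e1 e2 e3 X)"
proof -
  let ?w = "wanas_form0 br g J e1 e2 e3"
  have w: "linear (\<lambda>X. ?w X Y)" "linear (?w X)" for X Y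
    using bilinear_wanas_form0[OF assms] by (auto simp: bilinear_def)
  have G: "g (sharp (?w X)) Y = ?w X Y" for X Y
    by (rule g_sharp) (rule w)
  have lin: "linear (\<lambda>X. sharp (?w X))"
    by (intro linearI g_eqI) (simp_all add: G g_simps w(1)[THEN linear_add] w(1)[THEN linear_cmul])
  have eq: "Wan0 br g J e1 e2 e3 = (\<lambda>X. sharp (?w X))"
    unfolding Wan0_def
  proof (rule the_equality)
    fix L assume "linear L \<and> (\<forall>X Y. ?w X Y = g (L X) Y)"
    then show "L = (\<lambda>X. sharp (?w X))"
      by (intro ext g_eqI) (simp add: G)
  qed (simp add: lin G)
  show "linear (Wan0 br g J e1 e2 e3)" using lin by (simp add: eq)
  show "Wan0 br g J e1 e2 e3 X = sharp (?w X)" by (simp add: eq)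
qed

text \<open>Both sides of the Leibniz rule are bilinear and skew in \<open>X\<close>,
  \<open>Y\<close>, so three of the nine pairs of frame vectors suffice.\<close>

lemma lie_derivationI:
  assumes D: "linear D"
    and "D (br e1 e2) = br (D e1) e2 + br e1 (D e2)"
    and "D (br e1 e3) = br (D e1) e3 + br e1 (D e3)"
    and "D (br e2 e3) = br (D e2) e3 + br e2 (D e3)"
  shows "lie_derivation br D"
proof -
  have skew: "D (br Y X) = br (D Y) X + br Y (D X)"
    if "D (br X Y) = br (D X) Y + br X (D Y)" for X Y
    using that br_skew[of X Y] br_skew[of "D X" Y] br_skew[of X "D Y"]
    by (simp add: linear_neg[OF D] algebra_simps minus_equation_iff)
  have self: "br (D X) X + br X (D X) = 0" for X
    using br_skew[of X "D X"] by simp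
  have "(\<lambda>X Y. D (br X Y)) = (\<lambda>X Y. br (D X) Y + br X (D Y))"
  proof (rule bilinear_eqI)
    show "bilinear (\<lambda>X Y. D (br X Y))" "bilinear (\<lambda>X Y. br (D X) Y + br X (D Y))"
      unfolding bilinear_def
      by (intro conjI allI linearI;
          simp add: linear_add[OF D] linear_cmul[OF D] br_simps algebra_simps)+
  qed (simp_all add: assms skew self linear_0[OF D])
  then show ?thesis
    unfolding lie_derivation_def using D by (metis (no_types))
qed

end

section \<open>The Lie algebra of the theorem and its Wanas operator\<close>

locale framed_lie_algebra_G2 = framed_lie_algebra +
  fixes \<alpha> \<beta> \<gamma> :: real and J :: "'a::real_vector \<Rightarrow> 'a"
  assumes br12: "br e1 e2 = \<gamma> *\<^sub>R e2 - \<beta> *\<^sub>R e3"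
    and br13: "br e1 e3 = - \<beta> *\<^sub>R e2 - \<gamma> *\<^sub>R e3"
    and br23: "br e2 e3 = \<alpha> *\<^sub>R e1"
    and linear_J: "linear J"
    and J_frame: "J e1 = e1" "J e2 = e2" "J e3 = - e3"
begin

lemma br_frame:
  "br e1 e2 = \<gamma> *\<^sub>R e2 - \<beta> *\<^sub>R e3" "br e2 e1 = \<beta> *\<^sub>R e3 - \<gamma> *\<^sub>R e2"
  "br e1 e3 = - \<beta> *\<^sub>R e2 - \<gamma> *\<^sub>R e3" "br e3 e1 = \<beta> *\<^sub>R e2 + \<gamma> *\<^sub>R e3"
  "br e2 e3 = \<alpha> *\<^sub>R e1" "br e3 e2 = - \<alpha> *\<^sub>R e1"
  using br12 br13 br23 br_skew[of e2 e1] br_skew[of e3 e1] br_skew[of e3 e2] by simp_all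

abbreviation "nab0 \<equiv> canonical_connection br g J"

text \<open>Since \<open>J\<close> is an involution, \<open>nab0 X Y\<close> is half the sum of the
  Levi-Civita derivative of \<open>Y\<close> along \<open>X\<close> and its conjugate by
  \<open>J\<close>. This removes the components mixing \<open>e3\<close> with the plane of
  \<open>e1\<close>, \<open>e2\<close>. The rotation form takes the values 0, \<gamma>, - \<alpha> /
  2 on the frame.\<close>

lemma nab0_frame:
  "nab0 e1 e1 = 0" "nab0 e1 e2 = 0" "nab0 e1 e3 = 0"
  "nab0 e2 e1 = - \<gamma> *\<^sub>R e2" "nab0 e2 e2 = \<gamma> *\<^sub>R e1" "nab0 e2 e3 = 0"
  "nab0 e3 e1 = (\<alpha> / 2) *\<^sub>R e2" "nab0 e3 e2 = - (\<alpha> / 2) *\<^sub>R e1" "nab0 e3 e3 = 0"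
  by (rule frame_eqI;
      simp add: canonical_connection_def cov_deriv_endo_def J_frame levi_civita_eq
        bilinear_rneg[OF bilinear_levi_civita] sharp_def koszul_def br_frame br_simps g_simps
        linear_add[OF linear_J] linear_diff[OF linear_J] linear_cmul[OF linear_J]
        linear_neg[OF linear_J] linear_0[OF linear_J] field_simps)+

abbreviation "tor0 \<equiv> torsion br nab0"

lemma tor0_frame:
  "tor0 e1 e1 = 0" "tor0 e2 e2 = 0" "tor0 e3 e3 = 0"
  "tor0 e1 e2 = \<beta> *\<^sub>R e3" "tor0 e2 e1 = - \<beta> *\<^sub>R e3"
  "tor0 e1 e3 = (\<beta> - \<alpha> / 2) *\<^sub>R e2 + \<gamma> *\<^sub>R e3" "tor0 e3 e1 = (\<alpha> / 2 - \<beta>) *\<^sub>R e2 - \<gamma> *\<^sub>R e3"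
  "tor0 e2 e3 = - (\<alpha> / 2) *\<^sub>R e1" "tor0 e3 e2 = (\<alpha> / 2) *\<^sub>R e1"
  by (rule frame_eqI; simp add: torsion_def nab0_frame br_frame g_simps)+

lemma bilinear_tor0: "bilinear tor0"
proof -
  note N = bilinear_canonical_connection[OF linear_J]
  show ?thesis
    unfolding bilinear_def
    by (intro conjI allI linearI)
      (simp_all add: torsion_def bilinear_ladd[OF N] bilinear_radd[OF N] bilinear_lmul[OF N]
        bilinear_rmul[OF N] br_simps algebra_simps)
qed

lemmas nab0_simps =
  bilinear_ladd[OF bilinear_canonical_connection[OF linear_J]]
  bilinear_radd[OF bilinear_canonical_connection[OF linear_J]]
  bilinear_lsub[OF bilinear_canonical_connection[OF linear_J]]
  bilinear_rsub[OF bilinear_canonical_connection[OF linear_J]]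
  bilinear_lmul[OF bilinear_canonical_connection[OF linear_J]]
  bilinear_rmul[OF bilinear_canonical_connection[OF linear_J]]
  bilinear_lneg[OF bilinear_canonical_connection[OF linear_J]]
  bilinear_rneg[OF bilinear_canonical_connection[OF linear_J]]
  bilinear_lzero[OF bilinear_canonical_connection[OF linear_J]]
  bilinear_rzero[OF bilinear_canonical_connection[OF linear_J]]

lemmas tor0_simps =
  bilinear_ladd[OF bilinear_tor0] bilinear_radd[OF bilinear_tor0]
  bilinear_lsub[OF bilinear_tor0] bilinear_rsub[OF bilinear_tor0]
  bilinear_lmul[OF bilinear_tor0] bilinear_rmul[OF bilinear_tor0]
  bilinear_lneg[OF bilinear_tor0] bilinear_rneg[OF bilinear_tor0]
  bilinear_lzero[OF bilinear_tor0] bilinear_rzero[OF bilinear_tor0]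

abbreviation "Wan \<equiv> Wan0 br g J e1 e2 e3"

text \<open>The Wanas form is not symmetrised, so \<open>Wan\<close> need not be self-adjoint and
  its two off-diagonal entries are independent data.\<close>

lemma Wan_frame:
  "Wan e1 = (\<alpha> * \<beta> / 2 - 2 * \<beta>\<^sup>2 - 2 * \<gamma>\<^sup>2) *\<^sub>R e1"
  "Wan e2 = (- \<gamma>\<^sup>2 - 3 * \<alpha> * \<beta> / 2) *\<^sub>R e2 + (\<alpha> * \<gamma> / 2) *\<^sub>R e3"
  "Wan e3 = (\<gamma> * (\<beta> - \<alpha>)) *\<^sub>R e2 + (\<alpha>\<^sup>2 / 2 - \<alpha> * \<beta>) *\<^sub>R e3"
  by (rule frame_eqI;
      simp add: Wan0_eq(2)[OF linear_J] sharp_def wanas_form0_def Let_def wanas_tensor_def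
        curvature_def nab0_frame tor0_frame br_frame nab0_simps tor0_simps g_simps;
      simp add: field_simps power2_eq_square)+

lemma derivation_Wan_iff:
  assumes "\<gamma> \<noteq> 0"
  shows "lie_derivation br (\<lambda>X. Wan X - c *\<^sub>R X) \<longleftrightarrow> \<alpha> = 0 \<and> \<beta> = 0 \<and> 2 * \<gamma>\<^sup>2 + c = 0"
    (is "lie_derivation br ?D \<longleftrightarrow> _")
proof
  define d1 where "d1 = \<alpha> * \<beta> / 2 - 2 * \<beta>\<^sup>2 - 2 * \<gamma>\<^sup>2 - c"
  define d2 where "d2 = - \<gamma>\<^sup>2 - 3 * \<alpha> * \<beta> / 2 - c"
  define d3 where "d3 = \<alpha>\<^sup>2 / 2 - \<alpha> * \<beta> - c"
  define p where "p = \<alpha> * \<gamma> / 2"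
  define q where "q = \<gamma> * (\<beta> - \<alpha>)"
  have De: "?D e1 = d1 *\<^sub>R e1" "?D e2 = d2 *\<^sub>R e2 + p *\<^sub>R e3" "?D e3 = q *\<^sub>R e2 + d3 *\<^sub>R e3"
    by (simp_all add: Wan_frame d1_def d2_def d3_def p_def q_def algebra_simps)
  assume der: "lie_derivation br ?D"
  then have lin: "linear ?D"
    and leib: "?D (br X Y) = br (?D X) Y + br X (?D Y)" for X Y
    by (auto simp: lie_derivation_def)
  note D_simps = linear_add[OF lin] linear_diff[OF lin] linear_cmul[OF lin] linear_neg[OF lin]
  have coord: "g (?D (br X Y)) Z = g (br (?D X) Y) Z + g (br X (?D Y)) Z" for X Y Z
    using leib[of X Y] by (simp add: g_simps)
  \<comment> \<open>The first four equations are the entries of \<open>D M - M D = d1 M\<close> on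
    \<open>P\<close>. The last, from the bracket of \<open>e2\<close> and \<open>e3\<close>, equates
    \<alpha> times \<open>d1\<close> with \<alpha> times the trace of \<open>D\<close> on
    \<open>P\<close>.\<close>
  have m: "\<gamma> * d2 - \<beta> * q = d1 * \<gamma> + d2 * \<gamma> - p * \<beta>"
    "\<gamma> * p - \<beta> * d3 = - (d1 * \<beta>) - d2 * \<beta> - p * \<gamma>"
    "- (\<beta> * d2) - \<gamma> * q = - (d1 * \<beta>) + q * \<gamma> - d3 * \<beta>"
    "- (\<beta> * p) - \<gamma> * d3 = - (d1 * \<gamma>) - q * \<beta> - d3 * \<gamma>"
    "\<alpha> * d1 = d2 * \<alpha> + d3 * \<alpha>"
    using coord[of e1 e2 e2] coord[of e1 e2 e3] coord[of e1 e3 e2] coord[of e1 e3 e3]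
      coord[of e2 e3 e1]
    unfolding br_frame D_simps De
    by (simp_all add: br_simps br_frame g_simps algebra_simps)
  \<comment> \<open>The trace argument: \<open>M\<close> squares to this factor times the identity
    of \<open>P\<close>.\<close>
  have "(\<beta>\<^sup>2 + \<gamma>\<^sup>2) * d1 = 0" using m by algebra
  moreover have "\<beta>\<^sup>2 + \<gamma>\<^sup>2 \<noteq> 0" using assms by (simp add: sum_power2_eq_zero_iff)
  ultimately have d1: "d1 = 0" by (metis mult_eq_0_iff)
  \<comment> \<open>With \<open>d1 = 0\<close> these are the conditions for \<open>D\<close> to
    commute with \<open>M\<close> that involve \<open>p - q\<close>.\<close>
  have "\<gamma> * (p - q) = 0 \<and> \<beta> * (p - q) = 0" using m d1 by algebra
  then have "p = q" using assms by simp
  then have \<beta>: "\<beta> = 3 * \<alpha> / 2" using assms by (simp add: p_def q_def field_simps)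
  have \<alpha>: "\<alpha> = 0"
  proof (rule ccontr)
    assume "\<alpha> \<noteq> 0"
    moreover have "\<alpha> * (d2 + d3) = 0" using m(5) d1 by (simp add: algebra_simps)
    ultimately have "d3 = - d2" by (simp add: add_eq_0_iff)
    \<comment> \<open>An off-diagonal entry of the commutator of \<open>D\<close> and
      \<open>M\<close>, with \<open>D\<close> traceless on \<open>P\<close>.\<close>
    then have "\<beta> * d2 = - (\<gamma> * p)" using m(2) d1 by simp
    then have "\<alpha> * (3 * d2 + \<gamma>\<^sup>2) = 0"
      by (simp add: \<beta> p_def power2_eq_square algebra_simps)
    then have "3 * d2 + \<gamma>\<^sup>2 = 0" using \<open>\<alpha> \<noteq> 0\<close> by simp
    \<comment> \<open>Eliminating \<open>c\<close> by \<open>d1 = 0\<close> shows that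
      \<open>d2\<close> is positive, whereas the previous equation makes it negative.\<close>
    moreover have "d2 = \<gamma>\<^sup>2 + 3 * \<alpha>\<^sup>2 / 2"
      using d1 by (simp add: d1_def d2_def \<beta> power2_eq_square field_simps)
    moreover have "\<gamma>\<^sup>2 > 0" "\<alpha>\<^sup>2 \<ge> 0" using assms by simp_all
    ultimately show False by linarith
  qed
  with \<beta> d1 show "\<alpha> = 0 \<and> \<beta> = 0 \<and> 2 * \<gamma>\<^sup>2 + c = 0"
    by (simp add: d1_def)
next
  assume *: "\<alpha> = 0 \<and> \<beta> = 0 \<and> 2 * \<gamma>\<^sup>2 + c = 0"
  then have c: "c = - 2 * \<gamma>\<^sup>2" by linarith
  have W: "linear Wan" by (rule Wan0_eq(1)[OF linear_J])
  show "lie_derivation br ?D"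
  \<comment> \<open>Here \<open>D\<close> is diagonal with entries 0,
    \<open>\<gamma>\<^sup>2\<close>, \<open>2 * \<gamma>\<^sup>2\<close>. It commutes with
    \<open>ad e1\<close>, which is diagonal too, and \<open>e2\<close>, \<open>e3\<close>
    commute.\<close>
  proof (rule lie_derivationI)
    show "linear ?D"
      by (rule linearI) (simp_all add: linear_add[OF W] linear_cmul[OF W] algebra_simps)
  qed (simp_all add: * c br_frame br_simps Wan_frame linear_add[OF W] linear_diff[OF W]
      linear_cmul[OF W] linear_neg[OF W] linear_0[OF W] algebra_simps)
qed

end

theorem theorem2p8:
  fixes br :: "'a::real_vector \<Rightarrow> 'a \<Rightarrow> 'a"
    and g :: "'a \<Rightarrow> 'a \<Rightarrow> real"
    and J :: "'a \<Rightarrow> 'a"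
    and e1 e2 e3 :: 'a
    and \<alpha> \<beta> \<gamma> c :: real
  assumes "\<gamma> \<noteq> 0"
    and "lie_bracket br"
    and "bilinear g" and "\<And>X Y. g X Y = g Y X"
    and "pseudo_orthonormal_basis g e1 e2 e3"
    and "br e1 e2 = \<gamma> *\<^sub>R e2 - \<beta> *\<^sub>R e3"
    and "br e1 e3 = - \<beta> *\<^sub>R e2 - \<gamma> *\<^sub>R e3"
    and "br e2 e3 = \<alpha> *\<^sub>R e1"
    and "linear J" and "J e1 = e1" and "J e2 = e2" and "J e3 = - e3"
  shows "(first_kind_algebraic_wanas_soliton0 br g J e1 e2 e3 c \<longleftrightarrow>
            \<alpha> = 0 \<and> \<beta> = 0 \<and> 2 * \<gamma>\<^sup>2 + c = 0 \<and> \<gamma> \<noteq> 0) \<and>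
         (\<alpha> = 0 \<and> \<beta> = 0 \<and> 2 * \<gamma>\<^sup>2 + c = 0 \<and> \<gamma> \<noteq> 0 \<longrightarrow>
            (\<forall>D. lie_derivation br D \<and> (\<forall>X. Wan0 br g J e1 e2 e3 X = c *\<^sub>R X + D X) \<longrightarrow>
                 D e1 = 0 \<and> D e2 = \<gamma>\<^sup>2 *\<^sub>R e2 \<and> D e3 = (2 * \<gamma>\<^sup>2) *\<^sub>R e3))"
proof -
  interpret framed_lie_algebra_G2 g e1 e2 e3 br \<alpha> \<beta> \<gamma> J
    by unfold_locales (use assms in \<open>auto simp: linear_add linear_cmul\<close>)
  \<comment> \<open>The soliton equation determines \<open>D\<close>, so both the existence claim
    and the claim about every \<open>D\<close> concern this single map.\<close>
  have D_eq: "(\<forall>X. Wan X = c *\<^sub>R X + D X) \<longleftrightarrow> D = (\<lambda>X. Wan X - c *\<^sub>R X)" for D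
    by (auto simp: fun_eq_iff algebra_simps)
  have "first_kind_algebraic_wanas_soliton0 br g J e1 e2 e3 c \<longleftrightarrow>
      lie_derivation br (\<lambda>X. Wan X - c *\<^sub>R X)"
    by (auto simp: first_kind_algebraic_wanas_soliton0_def D_eq)
  moreover have "D e1 = 0 \<and> D e2 = \<gamma>\<^sup>2 *\<^sub>R e2 \<and> D e3 = (2 * \<gamma>\<^sup>2) *\<^sub>R e3"
    if "\<alpha> = 0 \<and> \<beta> = 0 \<and> 2 * \<gamma>\<^sup>2 + c = 0" "D = (\<lambda>X. Wan X - c *\<^sub>R X)" for D
  proof -
    have "c = - 2 * \<gamma>\<^sup>2" using that(1) by linarith
    then show ?thesis
      using that by (auto intro!: frame_eqI simp: Wan_frame g_simps)
  qed
  ultimately show ?thesis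
    using derivation_Wan_iff[OF \<open>\<gamma> \<noteq> 0\<close>] \<open>\<gamma> \<noteq> 0\<close> by (simp add: D_eq)
qed

end
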